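(* Let $F(X,Z)\in\mathbb{Z}[X,Z]$ be a totally complex sextic binary form (i.e. with no real roots) factored over $\mathbb{R}$ as $$F(X,Z)=(X^2+a_1XZ+b_1Z^2)(X^2+a_2XZ+b_2Z^2)(X^2+a_3XZ+b_3Z^2),$$ and put $d_j=\sqrt{4b_j-a_j^2}$ for $j=1,2,3$, $\mathbf{d}=(d_1,d_2,d_3)$, $\mathbf{a}=(a_1,a_2,a_3)$, $\mathbf{b}=(b_1,b_2,b_3)$. Then the hyperbolic center zero map value $\xi_{\mathcal{C}}(F)=t+\mathbf{i}u\in\mathcal{H}_2$ of $F$ is given by $$t=-\frac12\,\psi(\mathbf{a},\mathbf{d}),\qquad u^2=\psi(\mathbf{b},\mathbf{d})-\frac14\,\psi^2(\mathbf{a},\mathbf{d}),$$ where $\psi^2(\mathbf{a},\mathbf{d})=(\psi(\mathbf{a},\mathbf{d}))^2$. The hyperbolic center quadratic $\mathcal{J}^{\mathcal{C}}_F$ is defined over $\mathbb{Q}(\sqrt{d_1},\sqrt{d_2},\sqrt{d_3})$.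
   Context: $\mathcal{H}_2$ is the upper half-plane. For $\alpha_j=x_j+\mathbf{i}y_j\in\mathcal{H}_2$, $j=1,\dots,n$, the hyperbolic center of mass $\mathcal{C}_{\mathcal{H}}(\alpha_1,\dots,\alpha_n)$ is the unique point $t+\mathbf{i}u\in\mathcal{H}_2$ that minimizes $$\sum_{j=1}^n\frac{(t-x_j)^2+(u-y_j)^2}{uy_j}.$$ Let $F(X,Z)$ be a real binary form of degree $2n$ with no real roots, factored as $F(X,Z)=\prod_{i=1}^n(X-\alpha_iZ)(X-\overline{\alpha_i}Z)$ with $\alpha_i\in\mathcal{H}_2$. The hyperbolic center zero map is $\xi_{\mathcal{C}}(F):=\mathcal{C}=\mathcal{C}_{\mathcal{H}}(\alpha_1,\dots,\alpha_n)\in\mathcal{H}_2$, and the hyperbolic center quadratic of $F$ is $\mathcal{J}^{\mathcal{C}}_F=(X-\mathcal{C}Z)(X-\overline{\mathcal{C}}Z)$. A form is defined over a field if its coefficients lie in that field. The function $\psi$ is defined, for $\mathbf{x}=(x_1,\dots,x_n)\in\mathbb{R}^n$ and $\mathbf{y}=(y_1,\dots,y_n)\in\mathbb{R}^n$ (with nonzero denominator), by $$\psi(\mathbf{x},\mathbf{y})=\frac{\sum_{i=1}^ny_1y_2\cdots y_{i-1}\,x_i\,y_{i+1}\cdots y_n}{\sum_{i=1}^ny_1y_2\cdots y_{i-1}\,y_{i+1}\cdots y_n}.$$ *)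

theory Defs
  imports "HOL-Analysis.Analysis" "HOL-Computational_Algebra.Computational_Algebra"
begin

(* A polynomial in X and Z over 'a is an element of 'a[Z][X]: the outer variable of
   the type 'a poly poly is X and the inner one is Z, so coeff (coeff F i) j is the
   coefficient of X^i Z^j. *)

definition form_X :: "'a::comm_ring_1 poly poly" where
  "form_X = [:0, 1:]"

definition form_Z :: "'a::comm_ring_1 poly poly" where
  "form_Z = [:[:0, 1:]:]"

definition form_const :: "'a::comm_ring_1 \<Rightarrow> 'a poly poly" where
  "form_const c = [:[:c:]:]"

definition form_eval :: "'a::comm_ring_1 poly poly \<Rightarrow> 'a \<Rightarrow> 'a \<Rightarrow> 'a" where
  "form_eval F x z = poly (poly F [:x:]) z"

definition form_map :: "('a::comm_ring_1 \<Rightarrow> 'b::comm_ring_1) \<Rightarrow> 'a poly poly \<Rightarrow> 'b poly poly" where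
  "form_map h F = map_poly (map_poly h) F"

definition binary_form :: "nat \<Rightarrow> 'a::comm_ring_1 poly poly \<Rightarrow> bool" where
  "binary_form m F \<longleftrightarrow> (\<forall>i j. coeff (coeff F i) j \<noteq> 0 \<longrightarrow> i + j = m)"

(* Roots are points of the real projective line, so [1:0] is excluded as a root too. *)
definition totally_complex :: "real poly poly \<Rightarrow> bool" where
  "totally_complex F \<longleftrightarrow> (\<forall>x z. form_eval F x z = 0 \<longrightarrow> x = 0 \<and> z = 0)"

definition form_defined_over :: "'a::comm_ring_1 set \<Rightarrow> 'a poly poly \<Rightarrow> bool" where
  "form_defined_over K F \<longleftrightarrow> (\<forall>i j. coeff (coeff F i) j \<in> K)"

definition upper_half_plane :: "complex set" where
  "upper_half_plane = {z. Im z > 0}"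

definition hyp_center_objective :: "complex list \<Rightarrow> complex \<Rightarrow> real" where
  "hyp_center_objective \<alpha>s w =
     (\<Sum>\<alpha>\<leftarrow>\<alpha>s. ((Re w - Re \<alpha>)\<^sup>2 + (Im w - Im \<alpha>)\<^sup>2) / (Im w * Im \<alpha>))"

definition hyp_center :: "complex list \<Rightarrow> complex" where
  "hyp_center \<alpha>s = (THE w. w \<in> upper_half_plane \<and>
     (\<forall>v\<in>upper_half_plane. hyp_center_objective \<alpha>s w \<le> hyp_center_objective \<alpha>s v))"

definition conj_quadratic :: "complex \<Rightarrow> complex poly poly" where
  "conj_quadratic \<alpha> =
     (form_X - form_const \<alpha> * form_Z) * (form_X - form_const (cnj \<alpha>) * form_Z)"

definition upper_root_list :: "real poly poly \<Rightarrow> complex list \<Rightarrow> bool" where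
  "upper_root_list F \<alpha>s \<longleftrightarrow> set \<alpha>s \<subseteq> upper_half_plane \<and>
     form_map complex_of_real F = (\<Prod>\<alpha>\<leftarrow>\<alpha>s. conj_quadratic \<alpha>)"

(* The list of upper roots is determined up to order, and hyp_center is symmetric. *)
definition hyp_center_zero :: "real poly poly \<Rightarrow> complex" where
  "hyp_center_zero F = (THE c. \<exists>\<alpha>s. upper_root_list F \<alpha>s \<and> c = hyp_center \<alpha>s)"

definition hyp_center_quadratic :: "real poly poly \<Rightarrow> complex poly poly" where
  "hyp_center_quadratic F = conj_quadratic (hyp_center_zero F)"

definition psi :: "real ^ 'n \<Rightarrow> real ^ 'n \<Rightarrow> real" where
  "psi x y = (\<Sum>i\<in>UNIV. x $ i * (\<Prod>j\<in>UNIV - {i}. y $ j)) /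
             (\<Sum>i\<in>UNIV. (\<Prod>j\<in>UNIV - {i}. y $ j))"

definition is_subfield :: "'a::field set \<Rightarrow> bool" where
  "is_subfield K \<longleftrightarrow> 0 \<in> K \<and> 1 \<in> K \<and>
     (\<forall>x\<in>K. \<forall>y\<in>K. x - y \<in> K \<and> x * y \<in> K) \<and> (\<forall>x\<in>K. inverse x \<in> K)"

(* The hull contains the prime field, so for S a set of complex numbers this is Q(S). *)
definition field_generated_by :: "'a::field set \<Rightarrow> 'a set" where
  "field_generated_by S = is_subfield hull S"

end

theory Submission
  imports Defs "HOL-Computational_Algebra.Field_as_Ring"
begin

text \<open>
  Write the roots in the upper half-plane as \<open>x j + \<i> y j\<close>, so that \<open>a j = -2 x j\<close>,
  \<open>b j = (x j)\<^sup>2 + (y j)\<^sup>2\<close> and \<open>d j = 2 y j\<close>. Up to a constant, the function minimised by the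
  hyperbolic center is \<open>S ((r - t)\<^sup>2 + u\<^sup>2 + v) / u\<close>, where \<open>S\<close> is the sum of the weights \<open>1 / y j\<close>, \<open>t\<close> is
  the weighted mean of the \<open>x j\<close>, and \<open>t\<^sup>2 + v\<close> is the weighted mean of the \<open>(x j)\<^sup>2 + (y j)\<^sup>2\<close>. Its only
  minimum is at \<open>t + \<i> sqrt v\<close> (\<open>hyp_center_closed_form\<close>). Since \<open>psi\<close> is exactly such a weighted mean
  (\<open>psi_eq_weighted_mean\<close>), the formulas for the real and imaginary part follow.

  The center quadratic is therefore \<open>X\<^sup>2 + psi a d X Z + psi b d Z\<^sup>2\<close>. The question is why its
  coefficients lie in the field \<open>K\<close> generated by the square roots of the \<open>d j\<close>, although the
  \<open>a j\<close> and \<open>b j\<close> themselves need not. What is needed is that the sums of \<open>x j / y j\<close>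
  and of \<open>(x j)\<^sup>2 / y j\<close> lie in \<open>K\<close>. The weight depends only on the height \<open>y j\<close>, which lies in \<open>K\<close>, so it
  is enough that \<open>K\<close> contains the power sums of the \<open>x j\<close> at each height. For the greatest height \<open>m\<close> this
  holds because the product of the \<open>X - x j\<close> with \<open>y j = m\<close> is the greatest common divisor of
  \<open>f(X + \<i> m)\<close> and \<open>f(X - \<i> m)\<close>, where \<open>f(X) = F(X, 1)\<close>, and the Euclidean algorithm stays inside
  \<open>K(\<i>)\<close> (\<open>top_level_over_subfield\<close>). Dividing \<open>f\<close> by the factors of greatest height and repeating
  treats the other heights (\<open>weighted_sums_in_subfield\<close>).
\<close>

section \<open>The hyperbolic center in closed form\<close>

text \<open>This is \<open>u\<close> times the objective at \<open>r + \<i> u\<close>. It is a polynomial in \<open>r\<close> and \<open>u\<close>, so it can also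
  be evaluated on the boundary \<open>u = 0\<close>.\<close>

lemma center_objective_expansion:
  assumes "set \<alpha>s \<subseteq> upper_half_plane"
  shows "(\<Sum>\<alpha>\<leftarrow>\<alpha>s. ((r - Re \<alpha>)\<^sup>2 + (u - Im \<alpha>)\<^sup>2) / Im \<alpha>) =
    (\<Sum>\<alpha>\<leftarrow>\<alpha>s. 1 / Im \<alpha>) * (r\<^sup>2 + u\<^sup>2) - 2 * r * (\<Sum>\<alpha>\<leftarrow>\<alpha>s. Re \<alpha> / Im \<alpha>)
    + (\<Sum>\<alpha>\<leftarrow>\<alpha>s. (cmod \<alpha>)\<^sup>2 / Im \<alpha>) - 2 * real (length \<alpha>s) * u"
  using assms
proof (induction \<alpha>s)
  case (Cons \<alpha> \<alpha>s)
  then have "Im \<alpha> \<noteq> 0" by (auto simp: upper_half_plane_def)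
  have "((r - Re \<alpha>)\<^sup>2 + (u - Im \<alpha>)\<^sup>2) / Im \<alpha> =
      ((r\<^sup>2 + u\<^sup>2) - 2 * r * Re \<alpha> + (cmod \<alpha>)\<^sup>2 - 2 * u * Im \<alpha>) / Im \<alpha>"
    unfolding cmod_power2 by (simp add: power2_eq_square algebra_simps)
  also have "\<dots> = 1 / Im \<alpha> * (r\<^sup>2 + u\<^sup>2) - 2 * r * (Re \<alpha> / Im \<alpha>) + (cmod \<alpha>)\<^sup>2 / Im \<alpha> - 2 * u"
    using \<open>Im \<alpha> \<noteq> 0\<close> by (simp add: add_divide_distrib diff_divide_distrib)
  finally have "((r - Re \<alpha>)\<^sup>2 + (u - Im \<alpha>)\<^sup>2) / Im \<alpha> =
      1 / Im \<alpha> * (r\<^sup>2 + u\<^sup>2) - 2 * r * (Re \<alpha> / Im \<alpha>) + (cmod \<alpha>)\<^sup>2 / Im \<alpha> - 2 * u" .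
  with Cons show ?case by (simp add: algebra_simps)
qed simp

lemma sum_list_pos_nonempty:
  fixes f :: "'a \<Rightarrow> real"
  assumes "xs \<noteq> []" "\<And>x. x \<in> set xs \<Longrightarrow> 0 < f x"
  shows "0 < (\<Sum>x\<leftarrow>xs. f x)"
  using assms
proof (induction xs rule: list_nonempty_induct)
  case (cons x xs)
  then have "0 < f x" "0 < (\<Sum>x\<leftarrow>xs. f x)" by auto
  then show ?case by simp
qed simp

text \<open>Completing both squares, the objective at \<open>r + \<i> u\<close> equals
  \<open>S (((r - t)\<^sup>2 + (u - sqrt v)\<^sup>2) / u + 2 sqrt v)\<close> minus the constant \<open>2 n\<close>, which is visibly minimal
  at \<open>t + \<i> sqrt v\<close> only.\<close>

lemma hyp_center_closed_form:
  assumes ne: "\<alpha>s \<noteq> []" and up: "set \<alpha>s \<subseteq> upper_half_plane"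
  defines "S \<equiv> (\<Sum>\<alpha>\<leftarrow>\<alpha>s. 1 / Im \<alpha>)"
  defines "t \<equiv> (\<Sum>\<alpha>\<leftarrow>\<alpha>s. Re \<alpha> / Im \<alpha>) / S"
  defines "v \<equiv> (\<Sum>\<alpha>\<leftarrow>\<alpha>s. (cmod \<alpha>)\<^sup>2 / Im \<alpha>) / S - t\<^sup>2"
  shows "0 < v" "hyp_center \<alpha>s = Complex t (sqrt v)"
proof -
  have pos: "0 < Im \<alpha>" if "\<alpha> \<in> set \<alpha>s" for \<alpha>
    using that up by (auto simp: upper_half_plane_def)
  have S: "0 < S"
    unfolding S_def by (rule sum_list_pos_nonempty) (use ne pos in auto)
  have A: "(\<Sum>\<alpha>\<leftarrow>\<alpha>s. Re \<alpha> / Im \<alpha>) = S * t" and B: "(\<Sum>\<alpha>\<leftarrow>\<alpha>s. (cmod \<alpha>)\<^sup>2 / Im \<alpha>) = S * (v + t\<^sup>2)"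
    using S by (simp_all add: t_def v_def)
  have expand: "(\<Sum>\<alpha>\<leftarrow>\<alpha>s. ((r - Re \<alpha>)\<^sup>2 + (u - Im \<alpha>)\<^sup>2) / Im \<alpha>) =
      S * ((r - t)\<^sup>2 + u\<^sup>2 + v) - 2 * real (length \<alpha>s) * u" for r u
    unfolding center_objective_expansion[OF up] A B S_def[symmetric]
    by (simp add: algebra_simps power2_eq_square)
  \<comment> \<open>At \<open>r = t\<close>, \<open>u = 0\<close> the expansion reduces to \<open>S v\<close>, while its terms are positive.\<close>
  have "0 < (\<Sum>\<alpha>\<leftarrow>\<alpha>s. ((t - Re \<alpha>)\<^sup>2 + (0 - Im \<alpha>)\<^sup>2) / Im \<alpha>)"
  proof (rule sum_list_pos_nonempty[OF ne])
    fix \<alpha> assume "\<alpha> \<in> set \<alpha>s"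
    then have "0 < Im \<alpha>" by (rule pos)
    then show "0 < ((t - Re \<alpha>)\<^sup>2 + (0 - Im \<alpha>)\<^sup>2) / Im \<alpha>"
      by (intro divide_pos_pos add_nonneg_pos) auto
  qed
  then show v: "0 < v"
    unfolding expand using S by (simp add: zero_less_mult_iff)
  define u0 where "u0 = sqrt v"
  have u0: "0 < u0" "u0\<^sup>2 = v" using v by (auto simp: u0_def)
  have objective: "hyp_center_objective \<alpha>s w =
      S * (((Re w - t)\<^sup>2 + (Im w - u0)\<^sup>2) / Im w + 2 * u0) - 2 * real (length \<alpha>s)"
    if "w \<in> upper_half_plane" for w
  proof -
    have w: "0 < Im w" using that by (simp add: upper_half_plane_def)
    have "hyp_center_objective \<alpha>s w =
      (\<Sum>\<alpha>\<leftarrow>\<alpha>s. ((Re w - Re \<alpha>)\<^sup>2 + (Im w - Im \<alpha>)\<^sup>2) / Im \<alpha> * (1 / Im w))"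
      by (simp add: hyp_center_objective_def mult.commute)
    also have "\<dots> = (S * ((Re w - t)\<^sup>2 + (Im w)\<^sup>2 + v) - 2 * real (length \<alpha>s) * Im w) * (1 / Im w)"
      unfolding sum_list_mult_const expand ..
    also have "\<dots> = S * (((Re w - t)\<^sup>2 + (Im w - u0)\<^sup>2) / Im w + 2 * u0) - 2 * real (length \<alpha>s)"
      using w unfolding u0(2)[symmetric] by (simp add: field_simps power2_eq_square)
    finally show ?thesis .
  qed
  let ?c = "Complex t u0"
  have c: "?c \<in> upper_half_plane" using u0 by (simp add: upper_half_plane_def)
  have "hyp_center \<alpha>s = ?c"
    unfolding hyp_center_def
  proof (rule the_equality, intro conjI ballI)
    fix w assume w: "w \<in> upper_half_plane"
    then have "0 \<le> ((Re w - t)\<^sup>2 + (Im w - u0)\<^sup>2) / Im w"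
      by (simp add: upper_half_plane_def)
    then show "hyp_center_objective \<alpha>s ?c \<le> hyp_center_objective \<alpha>s w"
      unfolding objective[OF w] objective[OF c] using S by simp
  next
    fix w assume "w \<in> upper_half_plane \<and>
      (\<forall>v\<in>upper_half_plane. hyp_center_objective \<alpha>s w \<le> hyp_center_objective \<alpha>s v)"
    then have w: "w \<in> upper_half_plane" and "hyp_center_objective \<alpha>s w \<le> hyp_center_objective \<alpha>s ?c"
      using c by auto
    then have "((Re w - t)\<^sup>2 + (Im w - u0)\<^sup>2) / Im w \<le> 0"
      unfolding objective[OF w] objective[OF c] using S by simp
    then have "(Re w - t)\<^sup>2 + (Im w - u0)\<^sup>2 \<le> 0"
      using w by (simp add: upper_half_plane_def divide_le_0_iff)
    then have "Re w = t \<and> Im w = u0"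
      by (smt (verit) zero_le_power2 power2_eq_iff_nonneg zero_eq_power2)
    then show "w = ?c" by (simp add: complex_eq_iff)
  qed (rule c)
  then show "hyp_center \<alpha>s = Complex t (sqrt v)" by (simp add: u0_def)
qed

text \<open>Dividing numerator and denominator by the product of all \<open>y $ i\<close> shows that \<open>psi x y\<close> is the mean
  of the \<open>x $ i\<close> with weights \<open>1 / y $ i\<close>, the same shape as the closed form of the center.\<close>

lemma psi_eq_weighted_mean:
  fixes x y :: "real ^ 'n"
  assumes "\<And>i. y $ i \<noteq> 0"
  shows "psi x y = (\<Sum>i\<in>UNIV. x $ i / y $ i) / (\<Sum>i\<in>UNIV. 1 / y $ i)"
proof -
  define P where "P = (\<Prod>j\<in>UNIV. y $ j)"
  have P: "P \<noteq> 0" using assms by (simp add: P_def)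
  have "(\<Prod>j\<in>UNIV - {i}. y $ j) = P / y $ i" for i
    unfolding P_def using assms prod.remove[of UNIV i "\<lambda>j. y $ j"] by simp
  then have "psi x y = (P * (\<Sum>i\<in>UNIV. x $ i / y $ i)) / (P * (\<Sum>i\<in>UNIV. 1 / y $ i))"
    by (simp add: psi_def sum_distrib_left mult.commute)
  with P show ?thesis by simp
qed

section \<open>Forms, their dehomogenisation and their upper roots\<close>

lemma map_poly_mult_hom:
  fixes h :: "'a::comm_ring_1 \<Rightarrow> 'b::comm_ring_1"
  assumes h: "h 0 = 0" "\<And>x y. h (x + y) = h x + h y" "\<And>x y. h (x * y) = h x * h y"
  shows "map_poly h (p * q) = map_poly h p * map_poly h q"
proof (rule poly_eqI)
  fix n
  have sum: "h (\<Sum>i\<in>A. f i) = (\<Sum>i\<in>A. h (f i))" for f and A :: "nat set"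
    by (induction A rule: infinite_finite_induct) (auto simp: h)
  show "coeff (map_poly h (p * q)) n = coeff (map_poly h p * map_poly h q) n"
    by (simp add: coeff_map_poly coeff_mult h sum)
qed

lemma map_poly_add_hom:
  fixes h :: "'a::comm_ring_1 \<Rightarrow> 'b::comm_ring_1"
  assumes h: "h 0 = 0" "\<And>x y. h (x + y) = h x + h y"
  shows "map_poly h (p + q) = map_poly h p + map_poly h q"
  by (rule poly_eqI) (simp add: coeff_map_poly h)

lemma form_map_of_real_prod:
  "form_map complex_of_real (\<Prod>j\<in>J. G j) = (\<Prod>j\<in>J. form_map complex_of_real (G j))"
proof -
  have "form_map complex_of_real (p * q) = form_map complex_of_real p * form_map complex_of_real q" for p q
    unfolding form_map_def
    by (rule map_poly_mult_hom) (auto intro!: map_poly_mult_hom map_poly_add_hom)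
  then show ?thesis
    by (induction J rule: infinite_finite_induct) (auto simp: form_map_def)
qed

definition dehomogenise :: "'a::comm_ring_1 poly poly \<Rightarrow> 'a poly" where
  "dehomogenise F = map_poly (\<lambda>p. poly p 1) F"

lemma dehomogenise_mult: "dehomogenise (p * q) = dehomogenise p * dehomogenise q"
  unfolding dehomogenise_def by (rule map_poly_mult_hom) auto

lemma dehomogenise_1: "dehomogenise 1 = 1"
  by (simp add: dehomogenise_def)

lemma dehomogenise_prod: "dehomogenise (\<Prod>j\<in>J. G j) = (\<Prod>j\<in>J. dehomogenise (G j))"
  by (induction J rule: infinite_finite_induct) (auto simp: dehomogenise_mult dehomogenise_1)

lemma conj_quadratic_explicit:
  "conj_quadratic \<alpha> = [:[:0, 0, of_real ((cmod \<alpha>)\<^sup>2):], [:0, - of_real (2 * Re \<alpha>):], 1:]"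
  using complex_norm_square[of \<alpha>] complex_add_cnj[of \<alpha>]
  by (simp add: conj_quadratic_def form_X_def form_Z_def form_const_def one_pCons
        eq_neg_iff_add_eq_0 algebra_simps)

lemma dehomogenise_conj_quadratic: "dehomogenise (conj_quadratic \<alpha>) = [:- \<alpha>, 1:] * [:- cnj \<alpha>, 1:]"
  using complex_norm_square[of \<alpha>] complex_add_cnj[of \<alpha>]
  by (simp add: conj_quadratic_explicit dehomogenise_def map_poly_pCons
        eq_neg_iff_add_eq_0 algebra_simps)

lemma form_map_real_quadratic:
  assumes "a = - 2 * Re \<alpha>" "b = (cmod \<alpha>)\<^sup>2"
  shows "form_map complex_of_real
           (form_X ^ 2 + form_const a * form_X * form_Z + form_const b * form_Z ^ 2) = conj_quadratic \<alpha>"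
  unfolding assms conj_quadratic_explicit
  by (simp add: form_map_def form_X_def form_Z_def form_const_def power2_eq_square map_poly_pCons one_pCons)

text \<open>This recovers the list from the form up to order, which makes the center zero map well defined;
  the second conjunct keeps the induction going, as root multisets add only for nonzero factors.\<close>

lemma upper_roots_of_product:
  assumes "set \<alpha>s \<subseteq> upper_half_plane"
  shows "filter_mset (\<lambda>z. 0 < Im z) (proots (dehomogenise (\<Prod>\<alpha>\<leftarrow>\<alpha>s. conj_quadratic \<alpha>))) = mset \<alpha>s
    \<and> dehomogenise (\<Prod>\<alpha>\<leftarrow>\<alpha>s. conj_quadratic \<alpha>) \<noteq> 0"
  using assms
proof (induction \<alpha>s)
  case (Cons \<alpha> \<alpha>s)
  have "proots ([:- \<alpha>, 1:] * [:- cnj \<alpha>, 1:]) = {#\<alpha>, cnj \<alpha>#}"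
    by (subst proots_mult) auto
  with Cons show ?case
    by (auto simp: dehomogenise_mult dehomogenise_conj_quadratic proots_mult upper_half_plane_def
          simp del: mult_pCons_left mult_pCons_right)
qed (simp add: dehomogenise_1)

lemma hyp_center_zero_eq:
  assumes "upper_root_list F \<alpha>s"
  shows "hyp_center_zero F = hyp_center \<alpha>s"
  unfolding hyp_center_zero_def
proof (rule the_equality)
  show "\<exists>\<beta>s. upper_root_list F \<beta>s \<and> hyp_center \<alpha>s = hyp_center \<beta>s"
    using assms by blast
next
  fix c assume "\<exists>\<beta>s. upper_root_list F \<beta>s \<and> c = hyp_center \<beta>s"
  then obtain \<beta>s where \<beta>s: "upper_root_list F \<beta>s" "c = hyp_center \<beta>s" by blast
  have "mset \<alpha>s = mset \<beta>s"
    using assms \<beta>s(1) upper_roots_of_product[of \<alpha>s] upper_roots_of_product[of \<beta>s]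
    by (auto simp: upper_root_list_def)
  then have "(\<Sum>\<alpha>\<leftarrow>\<alpha>s. f \<alpha>) = (\<Sum>\<alpha>\<leftarrow>\<beta>s. f \<alpha> :: real)" for f
    by (metis mset_map sum_mset_sum_list)
  then show "c = hyp_center \<alpha>s"
    by (simp add: \<beta>s(2) hyp_center_def hyp_center_objective_def)
qed

section \<open>Subfields and polynomials with coefficients in them\<close>

lemma is_subfield_field_generated_by: "is_subfield (field_generated_by S)"
  unfolding field_generated_by_def
  by (rule hull_in) (auto simp: is_subfield_def)

context
  fixes K :: "'a::field set"
  assumes K: "is_subfield K"
begin

lemma subfield_0: "0 \<in> K" and subfield_1: "1 \<in> K"
  using K by (auto simp: is_subfield_def)

lemma subfield_diff: "x \<in> K \<Longrightarrow> y \<in> K \<Longrightarrow> x - y \<in> K"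
  and subfield_mult: "x \<in> K \<Longrightarrow> y \<in> K \<Longrightarrow> x * y \<in> K"
  and subfield_inverse: "x \<in> K \<Longrightarrow> inverse x \<in> K"
  using K by (auto simp: is_subfield_def)

lemma subfield_uminus: "x \<in> K \<Longrightarrow> - x \<in> K"
  using subfield_diff[OF subfield_0] by simp

lemma subfield_add: "x \<in> K \<Longrightarrow> y \<in> K \<Longrightarrow> x + y \<in> K"
  using subfield_diff[of x "- y"] subfield_uminus by simp

lemma subfield_divide: "x \<in> K \<Longrightarrow> y \<in> K \<Longrightarrow> x / y \<in> K"
  by (simp add: divide_inverse subfield_mult subfield_inverse)

lemma subfield_power: "x \<in> K \<Longrightarrow> x ^ n \<in> K"
  by (induction n) (auto intro: subfield_1 subfield_mult)

lemma subfield_sum: "(\<And>i. i \<in> J \<Longrightarrow> f i \<in> K) \<Longrightarrow> sum f J \<in> K"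
  by (induction J rule: infinite_finite_induct) (auto intro: subfield_0 subfield_add)

lemma subfield_of_nat: "of_nat n \<in> K"
  by (induction n) (auto intro: subfield_0 subfield_1 subfield_add)

lemma subfield_of_int: "of_int k \<in> K"
  by (cases k) (auto intro: subfield_of_nat subfield_diff subfield_uminus subfield_1)

lemma subfield_numeral: "numeral k \<in> K"
  using subfield_of_nat[of "numeral k"] by simp

end

definition poly_over :: "'a::zero set \<Rightarrow> 'a poly \<Rightarrow> bool" where
  "poly_over K p \<longleftrightarrow> (\<forall>i. coeff p i \<in> K)"

context
  fixes K :: "'a::field set"
  assumes K: "is_subfield K"
begin

lemma poly_over_0: "poly_over K 0"
  by (simp add: poly_over_def subfield_0[OF K])

lemma poly_over_pCons_iff: "poly_over K (pCons c p) \<longleftrightarrow> c \<in> K \<and> poly_over K p"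
  by (auto simp: poly_over_def coeff_pCons split: nat.splits)

lemma poly_over_add: "poly_over K p \<Longrightarrow> poly_over K q \<Longrightarrow> poly_over K (p + q)"
  by (simp add: poly_over_def subfield_add[OF K])

lemma poly_over_diff: "poly_over K p \<Longrightarrow> poly_over K q \<Longrightarrow> poly_over K (p - q)"
  by (simp add: poly_over_def subfield_diff[OF K])

lemma poly_over_smult: "c \<in> K \<Longrightarrow> poly_over K p \<Longrightarrow> poly_over K (smult c p)"
  by (simp add: poly_over_def subfield_mult[OF K])

lemma poly_over_mult: "poly_over K p \<Longrightarrow> poly_over K q \<Longrightarrow> poly_over K (p * q)"
  by (simp add: poly_over_def coeff_mult subfield_sum[OF K] subfield_mult[OF K])

lemma poly_over_pcompose: "poly_over K p \<Longrightarrow> poly_over K q \<Longrightarrow> poly_over K (pcompose p q)"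
proof (induction p)
  case (pCons c p)
  then show ?case
    by (auto simp: pcompose_pCons poly_over_pCons_iff poly_over_0
             intro!: poly_over_add poly_over_mult)
qed (simp add: poly_over_0)

lemma poly_over_div_mod:
  assumes p: "poly_over K p" and q: "poly_over K q"
  shows "poly_over K (p div q) \<and> poly_over K (p mod q)"
  using p
proof (induction p)
  case (pCons c p)
  have "coeff (pCons c (p mod q)) (degree q) / lead_coeff q \<in> K"
    using pCons q by (intro subfield_divide[OF K])
      (auto simp: poly_over_def coeff_pCons split: nat.splits)
  with pCons q show ?case
    by (auto simp: div_pCons_eq mod_pCons_eq poly_over_pCons_iff poly_over_0
             intro!: poly_over_diff poly_over_smult)
qed (simp add: poly_over_0)

end

lemma unit_factor_field: "unit_factor c = (c :: 'a::field_gcd)"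
  by (cases "c = 0") (simp_all add: is_unit_unit_factor dvd_field_iff)

text \<open>The Euclidean algorithm never leaves the field of coefficients.\<close>

lemma poly_over_gcd:
  fixes p q :: "'a::field_gcd poly"
  assumes K: "is_subfield K" and "poly_over K p" "poly_over K q"
  shows "poly_over K (gcd p q)"
  using assms(2,3)
proof (induction p q rule: eucl_induct)
  case (zero p)
  then have "inverse (lead_coeff p) \<in> K"
    by (simp add: poly_over_def subfield_inverse[OF K])
  with zero show ?case
    by (simp add: normalize_poly_eq_map_poly poly_over_def coeff_map_poly
          unit_factor_field divide_inverse subfield_mult[OF K] subfield_inverse[OF K])
next
  case (mod p q)
  then have "poly_over K (gcd q (p mod q))"
    using poly_over_div_mod[OF K] by blast
  with mod show ?case
    by (simp add: gcd.commute)
qed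

section \<open>Sums over the roots weighted by their heights\<close>

text \<open>Newton's identity for the second power sum. Reversing the linear factors puts the elementary
  symmetric functions at the fixed positions 0, 1, 2, whatever the number of factors.\<close>

lemma coeff_prod_reversed_linear:
  fixes x :: "'i \<Rightarrow> 'a::field"
  assumes "finite J"
  defines "q \<equiv> \<Prod>j\<in>J. [:1, - x j:]"
  shows "coeff q 0 = 1" "coeff q 1 = - (\<Sum>j\<in>J. x j)"
    "2 * coeff q 2 = (\<Sum>j\<in>J. x j)\<^sup>2 - (\<Sum>j\<in>J. (x j)\<^sup>2)"
proof -
  have "coeff q 0 = 1 \<and> coeff q (Suc 0) = - (\<Sum>j\<in>J. x j) \<and>
        2 * coeff q (Suc (Suc 0)) = (\<Sum>j\<in>J. x j)\<^sup>2 - (\<Sum>j\<in>J. (x j)\<^sup>2)"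
    using assms(1) unfolding q_def
    by (induction J) (auto simp: mult_pCons_left algebra_simps power2_eq_square)
  then show "coeff q 0 = 1" "coeff q 1 = - (\<Sum>j\<in>J. x j)"
    "2 * coeff q 2 = (\<Sum>j\<in>J. x j)\<^sup>2 - (\<Sum>j\<in>J. (x j)\<^sup>2)"
    by (simp_all add: numeral_2_eq_2)
qed

lemma power_sums_in_subfield:
  fixes x :: "'i \<Rightarrow> 'a::field"
  assumes K: "is_subfield K" and J: "finite J" and p: "poly_over K (\<Prod>j\<in>J. [:- x j, 1:])"
  shows "(\<Sum>j\<in>J. x j) \<in> K" "(\<Sum>j\<in>J. (x j)\<^sup>2) \<in> K"
proof -
  define q where "q = (\<Prod>j\<in>J. [:1, - x j:])"
  have "q = reflect_poly (\<Prod>j\<in>J. [:- x j, 1:])"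
    unfolding q_def reflect_poly_prod by (rule prod.cong) (auto simp: reflect_poly_def)
  then have q: "coeff q i \<in> K" for i
    using p by (simp add: coeff_reflect_poly poly_over_def subfield_0[OF K])
  have "- coeff q 1 \<in> K" "(- coeff q 1)\<^sup>2 - 2 * coeff q 2 \<in> K"
    by (intro subfield_uminus[OF K] subfield_diff[OF K] subfield_mult[OF K]
          subfield_power[OF K] subfield_numeral[OF K] q)+
  then show "(\<Sum>j\<in>J. x j) \<in> K" "(\<Sum>j\<in>J. (x j)\<^sup>2) \<in> K"
    using coeff_prod_reversed_linear[OF J, of x] by (simp_all add: q_def)
qed

lemma coprime_linear_complex:
  assumes "a \<noteq> b"
  shows "coprime [:- a, 1:] [:- b, 1 :: complex:]"
proof (rule coprimeI)
  fix c assume "c dvd [:- a, 1:]" "c dvd [:- b, 1:]"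
  then have "c dvd [:- b, 1:] - [:- a, 1:]" by (rule dvd_diff[rotated])
  moreover have "[:- b, 1:] - [:- a, 1:] dvd 1"
    using assms by (simp add: is_unit_const_poly_iff dvd_field_iff)
  ultimately show "is_unit c" by (rule dvd_trans)
qed

abbreviation conj_pair :: "real \<Rightarrow> real \<Rightarrow> complex poly" where
  "conj_pair x y \<equiv> [:- Complex x y, 1:] * [:- Complex x (- y), 1:]"

text \<open>Among roots \<open>x j \<plusminus> \<i> y j\<close>, those at the greatest height \<open>m\<close> can be isolated rationally. Translate
  the roots of \<open>f\<close> down by \<open>m\<close> and up by \<open>m\<close>. The first translate has all its roots in the closed lower
  half-plane, the second in the closed upper one, and each meets the real axis exactly at the points
  \<open>x j\<close> with \<open>y j = m\<close>, with the same multiplicities. Hence the greatest common divisor of the two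
  translates is the product of the \<open>X - x j\<close> over the top level.\<close>

lemma top_level_over_subfield:
  fixes x y :: "'i \<Rightarrow> real" and m :: real
  assumes L: "is_subfield L" and iL: "\<i> \<in> L" and J: "finite J"
    and pos: "\<And>j. j \<in> J \<Longrightarrow> 0 < y j" and le: "\<And>j. j \<in> J \<Longrightarrow> y j \<le> m"
    and mL: "complex_of_real m \<in> L"
    and f: "poly_over L (\<Prod>j\<in>J. conj_pair (x j) (y j))"
  shows "poly_over L (\<Prod>j\<in>{j\<in>J. y j = m}. [:- complex_of_real (x j), 1:])"
proof -
  define f where "f = (\<Prod>j\<in>J. conj_pair (x j) (y j))"
  define M where "M = {j\<in>J. y j = m}"
  define P where "P = (\<Prod>j\<in>M. [:- complex_of_real (x j), 1:])"
  \<comment> \<open>The non-real roots after translation: for \<open>s = 1\<close> (moved up) they lie in the upper half-plane,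
     for \<open>s = -1\<close> in the lower one.\<close>
  define R where "R s = (\<Prod>j\<in>J-M. [:- Complex (x j) (s * (m - y j)), 1:]) *
                        (\<Prod>j\<in>J. [:- Complex (x j) (s * (m + y j)), 1:])" for s :: real
  have M: "finite M" "M \<subseteq> J" using J by (auto simp: M_def)
  have shift: "pcompose f [:- (of_real s * of_real m * \<i>), 1:] = P * R s" if "s = 1 \<or> s = -1" for s :: real
  proof -
    have "pcompose f [:- (of_real s * of_real m * \<i>), 1:] =
       (\<Prod>j\<in>J. [:- Complex (x j) (s * (m - y j)), 1:] * [:- Complex (x j) (s * (m + y j)), 1:])"
      unfolding f_def pcompose_prod
      by (rule prod.cong) (use that in \<open>auto simp: pcompose_mult pcompose_pCons complex_eq_iff algebra_simps\<close>)
    also have "\<dots> = (\<Prod>j\<in>M. [:- Complex (x j) (s * (m - y j)), 1:]) * R s"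
      by (simp only: R_def prod.distrib
            prod.subset_diff[OF M(2) J, of "\<lambda>j. [:- Complex (x j) (s * (m - y j)), 1:]"] mult_ac)
    also have "(\<Prod>j\<in>M. [:- Complex (x j) (s * (m - y j)), 1:]) = P"
      unfolding P_def by (rule prod.cong) (auto simp: M_def complex_eq_iff)
    finally show ?thesis .
  qed
  have "coprime (R 1) (R (- 1))"
  proof -
    have 1: "0 < m - y j" if "j \<in> J - M" for j
      using le[of j] that by (auto simp: M_def)
    have 2: "0 < m + y j" if "j \<in> J" for j
      using le[of j] pos[of j] that by auto
    have cop: "coprime [:- Complex u v, 1:] [:- Complex u' v', 1:]" if "v > 0" "v' < 0" for u v u' v'
      by (rule coprime_linear_complex) (use that in auto)
    show ?thesis
      unfolding R_def coprime_mult_left_iff coprime_mult_right_iff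
      by (intro conjI prod_coprime_left prod_coprime_right cop) (use 1 2 in force)+
  qed
  moreover have "normalize P = P"
    by (simp add: P_def normalize_poly_def lead_coeff_prod flip: one_pCons)
  ultimately have "P = gcd (P * R 1) (P * R (- 1))"
    by (simp add: gcd_mult_left)
  moreover have "poly_over L (P * R s)" if "s = 1 \<or> s = -1" for s :: real
    unfolding shift[OF that, symmetric]
    using that f mL iL
    by (intro poly_over_pcompose[OF L])
       (auto simp: f_def poly_over_pCons_iff[OF L] poly_over_0[OF L] subfield_1[OF L]
             intro!: subfield_uminus[OF L] subfield_mult[OF L])
  ultimately show ?thesis
    using poly_over_gcd[OF L, of "P * R 1" "P * R (- 1)"] by (simp add: P_def M_def)
qed

text \<open>The individual \<open>x j\<close> need not lie in \<open>L\<close>. But the weight \<open>1 / y j\<close> is constant on each level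
  \<open>y j = m\<close>, and on a level the power sums of the \<open>x j\<close> do lie in \<open>L\<close>: the top level is split off by
  the previous lemma, and dividing by its factors \<open>(X - x j)\<^sup>2 + m\<^sup>2\<close> leaves a polynomial over \<open>L\<close> with
  fewer roots.\<close>

lemma weighted_sums_in_subfield:
  fixes x y :: "'i \<Rightarrow> real"
  assumes L: "is_subfield L" and iL: "\<i> \<in> L" and "finite J"
    and "\<And>j. j \<in> J \<Longrightarrow> 0 < y j" and "\<And>j. j \<in> J \<Longrightarrow> complex_of_real (y j) \<in> L"
    and "poly_over L (\<Prod>j\<in>J. conj_pair (x j) (y j))"
  shows "(\<Sum>j\<in>J. complex_of_real (x j / y j)) \<in> L \<and> (\<Sum>j\<in>J. complex_of_real ((x j)\<^sup>2 / y j)) \<in> L"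
  using assms(3-)
proof (induction J rule: finite_psubset_induct)
  case (psubset J)
  show ?case
  proof (cases "J = {}")
    case False
    define m where "m = Max (y ` J)"
    define M where "M = {j\<in>J. y j = m}"
    define P where "P = (\<Prod>j\<in>M. [:- complex_of_real (x j), 1:])"
    have "m \<in> y ` J" unfolding m_def using psubset False by (intro Max_in) auto
    then have M: "M \<subseteq> J" "M \<noteq> {}" "finite M" and mL: "complex_of_real m \<in> L"
      using psubset by (auto simp: M_def)
    have P: "poly_over L P"
      unfolding P_def M_def
      by (rule top_level_over_subfield[OF L iL psubset(1)]) (use psubset mL in \<open>auto simp: m_def\<close>)
    have split: "(\<Prod>j\<in>J. conj_pair (x j) (y j)) =
      (\<Prod>j\<in>M. conj_pair (x j) (y j)) * (\<Prod>j\<in>J-M. conj_pair (x j) (y j))"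
      by (subst mult.commute, rule prod.subset_diff) (use psubset M in auto)
    \<comment> \<open>If \<open>P\<close> has the roots \<open>x j\<close>, its two vertical translates have the roots \<open>x j \<plusminus> \<i> m\<close>.\<close>
    have top: "(\<Prod>j\<in>M. conj_pair (x j) (y j)) =
        pcompose P [:- (of_real m * \<i>), 1:] * pcompose P [:of_real m * \<i>, 1:]"
      unfolding P_def pcompose_prod prod.distrib[symmetric]
      by (rule prod.cong) (auto simp: M_def pcompose_pCons complex_eq_iff)
    have top_over: "poly_over L (\<Prod>j\<in>M. conj_pair (x j) (y j))"
      unfolding top using P mL iL
      by (intro poly_over_pcompose[OF L] poly_over_mult[OF L])
         (auto simp: poly_over_pCons_iff[OF L] poly_over_0[OF L] subfield_1[OF L]
             intro!: subfield_uminus[OF L] subfield_mult[OF L])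
    have "(\<Prod>j\<in>M. conj_pair (x j) (y j)) \<noteq> 0"
      using M by (auto simp del: mult_pCons_left mult_pCons_right)
    then have "(\<Prod>j\<in>J-M. conj_pair (x j) (y j)) =
        (\<Prod>j\<in>J. conj_pair (x j) (y j)) div (\<Prod>j\<in>M. conj_pair (x j) (y j))"
      unfolding split by (rule nonzero_mult_div_cancel_left[symmetric])
    then have rest: "poly_over L (\<Prod>j\<in>J-M. conj_pair (x j) (y j))"
      using poly_over_div_mod[OF L psubset.prems(3) top_over] by simp
    have IH: "(\<Sum>j\<in>J-M. complex_of_real (x j / y j)) \<in> L"
      "(\<Sum>j\<in>J-M. complex_of_real ((x j)\<^sup>2 / y j)) \<in> L"
      using psubset.IH[of "J - M"] psubset.prems rest M by blast+
    have "(\<Sum>j\<in>M. complex_of_real (x j)) / of_real m \<in> L"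
      "(\<Sum>j\<in>M. (complex_of_real (x j))\<^sup>2) / of_real m \<in> L"
      using power_sums_in_subfield[OF L M(3) P[unfolded P_def]] mL
      by (auto intro: subfield_divide[OF L])
    moreover have "(\<Sum>j\<in>M. complex_of_real (x j)) / of_real m = (\<Sum>j\<in>M. complex_of_real (x j / y j))"
      "(\<Sum>j\<in>M. (complex_of_real (x j))\<^sup>2) / of_real m = (\<Sum>j\<in>M. complex_of_real ((x j)\<^sup>2 / y j))"
      unfolding sum_divide_distrib by (auto simp: M_def intro!: sum.cong)
    ultimately show ?thesis
      using IH by (auto simp: sum.subset_diff[OF M(1) psubset.hyps] intro: subfield_add[OF L])
  qed (simp add: subfield_0[OF L])
qed

section \<open>The sextic and its center\<close>

text \<open>For a field \<open>K\<close> generated by real numbers, this set is \<open>K(\<i>)\<close>. Its real elements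
  lie in \<open>K\<close>, so real quantities shown to lie in the extension descend to \<open>K\<close>.\<close>

lemma subfield_adjoin_i:
  assumes K: "is_subfield K"
  shows "is_subfield {z. complex_of_real (Re z) \<in> K \<and> complex_of_real (Im z) \<in> K}"
proof -
  have "complex_of_real (Re x * Re y - Im x * Im y) \<in> K" "complex_of_real (Re x * Im y + Im x * Re y) \<in> K"
    if "complex_of_real (Re x) \<in> K" "complex_of_real (Im x) \<in> K"
       "complex_of_real (Re y) \<in> K" "complex_of_real (Im y) \<in> K" for x y
    using that by (simp_all add: subfield_add[OF K] subfield_diff[OF K] subfield_mult[OF K])
  moreover have "complex_of_real (Re (inverse x)) \<in> K" "complex_of_real (Im (inverse x)) \<in> K"
    if "complex_of_real (Re x) \<in> K" "complex_of_real (Im x) \<in> K" for x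
    using that by (auto intro!: subfield_divide[OF K] subfield_add[OF K] subfield_power[OF K]
      subfield_uminus[OF K])
  ultimately show ?thesis
    by (auto simp: is_subfield_def subfield_0[OF K] subfield_1[OF K] subfield_diff[OF K]
          simp del: inverse_complex.sel)
qed

text \<open>Every subfield contains the integers.\<close>

lemma dehomogenise_int_form_over:
  assumes K: "is_subfield (K :: complex set)"
  shows "poly_over K (dehomogenise (form_map complex_of_real (form_map real_of_int F)))"
proof -
  have value_at_1: "poly p 1 \<in> K" if "poly_over K p" for p
    using that by (induction p)
      (auto simp: poly_over_pCons_iff[OF K] intro: subfield_0[OF K] subfield_add[OF K])
  have "poly_over K (map_poly complex_of_real (map_poly real_of_int q))" for q
    by (simp add: poly_over_def coeff_map_poly subfield_of_int[OF K])
  then show ?thesis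
    unfolding poly_over_def[of K "dehomogenise F" for F]
    by (simp add: dehomogenise_def form_map_def coeff_map_poly value_at_1)
qed

text \<open>Otherwise the quadratic formula would give a real root \<open>[r : 1]\<close> of the form.\<close>

lemma totally_complex_quadratic_factor:
  assumes "totally_complex (\<Prod>j\<in>J. form_X ^ 2 + form_const (a j) * form_X * form_Z
                      + form_const (b j) * form_Z ^ 2)" and J: "finite J" "j \<in> J"
  shows "(a j)\<^sup>2 < 4 * b j"
proof (rule ccontr)
  assume "\<not> (a j)\<^sup>2 < 4 * b j"
  then have disc: "0 \<le> (a j)\<^sup>2 - 4 * b j" by simp
  define r where "r = (- a j + sqrt ((a j)\<^sup>2 - 4 * b j)) / 2"
  have "2 * r + a j = sqrt ((a j)\<^sup>2 - 4 * b j)"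
    by (simp add: r_def)
  then have "(2 * r + a j)\<^sup>2 = (a j)\<^sup>2 - 4 * b j"
    using disc by simp
  then have r: "r\<^sup>2 + a j * r + b j = 0"
    by (simp add: power2_eq_square algebra_simps)
  have "form_eval (\<Prod>j\<in>J. form_X ^ 2 + form_const (a j) * form_X * form_Z
                      + form_const (b j) * form_Z ^ 2) r 1 = (\<Prod>j\<in>J. r\<^sup>2 + a j * r + b j)"
    by (simp add: form_eval_def poly_prod form_X_def form_Z_def form_const_def)
  also have "\<dots> = 0" using J r by (intro prod_zero) auto
  finally have "r = 0 \<and> (1::real) = 0"
    using assms(1) unfolding totally_complex_def by (metis (no_types))
  then show False by simp
qed

theorem lemma2:
  fixes F :: "int poly poly" and a b d :: "real ^ 3"
  assumes "binary_form 6 F"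
    and "totally_complex (form_map real_of_int F)"
    and "form_map real_of_int F =
           (\<Prod>j\<in>UNIV. form_X ^ 2 + form_const (a $ j) * form_X * form_Z
                      + form_const (b $ j) * form_Z ^ 2)"
    and "d = (\<chi> j. sqrt (4 * b $ j - (a $ j)\<^sup>2))"
  shows "hyp_center_zero (form_map real_of_int F) \<in> upper_half_plane
       \<and> Re (hyp_center_zero (form_map real_of_int F)) = - (1 / 2) * psi a d
       \<and> (Im (hyp_center_zero (form_map real_of_int F)))\<^sup>2 = psi b d - (1 / 4) * (psi a d)\<^sup>2
       \<and> form_defined_over (field_generated_by (range (\<lambda>j. complex_of_real (sqrt (d $ j)))))
           (hyp_center_quadratic (form_map real_of_int F))"
proof -
  define G where "G = form_map real_of_int F"
  \<comment> \<open>\<open>\<alpha> j\<close> is the root in the upper half-plane of the \<open>j\<close>-th quadratic factor.\<close>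
  define x where "x j = - a $ j / 2" for j
  define y where "y j = d $ j / 2" for j
  define \<alpha> where "\<alpha> j = Complex (x j) (y j)" for j
  have "(a $ j)\<^sup>2 < 4 * b $ j" for j
    using totally_complex_quadratic_factor[of "\<lambda>j. a $ j" "\<lambda>j. b $ j" UNIV] assms(2,3) by simp
  then have d: "0 < d $ j" "(d $ j)\<^sup>2 = 4 * b $ j - (a $ j)\<^sup>2" for j
    using assms(4) by (simp_all add: less_imp_le)
  then have y: "0 < y j" for j by (simp add: y_def)
  have b: "b $ j = (x j)\<^sup>2 + (y j)\<^sup>2" for j
    using d(2)[of j] by (simp add: x_def y_def power_divide diff_divide_distrib)
  have factorisation: "form_map complex_of_real G = (\<Prod>j\<in>UNIV. conj_quadratic (\<alpha> j))"
    unfolding G_def assms(3) form_map_of_real_prod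
    by (intro prod.cong form_map_real_quadratic) (auto simp: \<alpha>_def x_def b cmod_power2)

  obtain js :: "3 list" where js: "set js = UNIV" "distinct js"
    using finite_distinct_list[of "UNIV :: 3 set"] by auto
  then have "js \<noteq> []" by auto
  have up: "set (map \<alpha> js) \<subseteq> upper_half_plane"
    using y by (auto simp: upper_half_plane_def \<alpha>_def)
  then have "upper_root_list G (map \<alpha> js)"
    unfolding upper_root_list_def factorisation
    using js by (simp add: comp_def prod.distinct_set_conv_list[of js, symmetric])
  then have center: "hyp_center_zero G = hyp_center (map \<alpha> js)"
    by (rule hyp_center_zero_eq)

  have sum_js: "(\<Sum>z\<leftarrow>map \<alpha> js. f z) = (\<Sum>j\<in>UNIV. f (\<alpha> j))" for f :: "complex \<Rightarrow> real"
    using js by (simp add: comp_def sum.distinct_set_conv_list[of js, symmetric])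
  define T where "T = (\<Sum>j\<in>UNIV. 1 / d $ j)"
  have "0 < T" unfolding T_def using d by (intro sum_pos) auto
  \<comment> \<open>Since \<open>d = 2 y\<close>, the weights \<open>1 / d\<close> are proportional to the weights \<open>1 / y\<close> of the center;
     the factors 2 below come from this.\<close>
  have psi: "psi c d = (\<Sum>j\<in>UNIV. c $ j / d $ j) / T" for c
    unfolding T_def by (rule psi_eq_weighted_mean) (use d in \<open>simp add: less_imp_neq[symmetric]\<close>)
  have S: "(\<Sum>z\<leftarrow>map \<alpha> js. 1 / Im z) = 2 * T"
    unfolding sum_js T_def by (simp add: \<alpha>_def y_def sum_distrib_left)
  have t: "(\<Sum>z\<leftarrow>map \<alpha> js. Re z / Im z) / (2 * T) = - (1 / 2) * psi a d"
    unfolding sum_js psi by (simp add: \<alpha>_def x_def y_def sum_negf)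
  have v: "(\<Sum>z\<leftarrow>map \<alpha> js. (cmod z)\<^sup>2 / Im z) / (2 * T) = psi b d"
  proof -
    have "(cmod (\<alpha> j))\<^sup>2 = b $ j" and Im: "Im (\<alpha> j) = d $ j / 2" for j
      by (simp_all add: \<alpha>_def cmod_power2 b y_def)
    then have "(cmod (\<alpha> j))\<^sup>2 / Im (\<alpha> j) = 2 * (b $ j / d $ j)" for j
      unfolding Im by simp
    then show ?thesis
      unfolding sum_js psi by (simp only: sum_distrib_left[symmetric])
  qed
  have "0 < psi b d - (- (1 / 2) * psi a d)\<^sup>2"
    and "hyp_center (map \<alpha> js) = Complex (- (1 / 2) * psi a d) (sqrt (psi b d - (- (1 / 2) * psi a d)\<^sup>2))"
    using hyp_center_closed_form[OF _ up] \<open>js \<noteq> []\<close> unfolding S t v by simp_all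
  then have re: "Re (hyp_center_zero G) = - (1 / 2) * psi a d"
    and im: "0 < Im (hyp_center_zero G)" "(Im (hyp_center_zero G))\<^sup>2 = psi b d - (1 / 4) * (psi a d)\<^sup>2"
    by (simp_all add: center power_divide)

  \<comment> \<open>The coefficients of the center quadratic are 1, \<open>-2 t = psi a d\<close> and
     \<open>t\<^sup>2 + u\<^sup>2 = psi b d\<close>, so it remains to place the two values of \<open>psi\<close> in \<open>K\<close>.\<close>
  define K where "K = field_generated_by (range (\<lambda>j. complex_of_real (sqrt (d $ j))))"
  define L where "L = {z. complex_of_real (Re z) \<in> K \<and> complex_of_real (Im z) \<in> K}"
  have K: "is_subfield K" unfolding K_def by (rule is_subfield_field_generated_by)
  have L: "is_subfield L" unfolding L_def by (rule subfield_adjoin_i[OF K])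
  have real_L: "complex_of_real r \<in> L \<longleftrightarrow> complex_of_real r \<in> K" for r
    by (simp add: L_def subfield_0[OF K])
  have dK: "complex_of_real (d $ j) \<in> K" for j
  proof -
    have "complex_of_real (sqrt (d $ j)) \<in> K"
      unfolding K_def field_generated_by_def by (rule hull_inc) simp
    from subfield_power[OF K this, of 2] show ?thesis
      using d(1)[of j] by (simp flip: of_real_power)
  qed
  then have yK: "complex_of_real (y j) \<in> K" for j
    by (simp add: y_def subfield_divide[OF K] subfield_numeral[OF K])
  have TK: "complex_of_real T \<in> K"
    unfolding T_def using dK
    by (auto intro!: subfield_sum[OF K] subfield_divide[OF K] subfield_1[OF K])
  have "dehomogenise (form_map complex_of_real G) = (\<Prod>j\<in>UNIV. conj_pair (x j) (y j))"
    unfolding factorisation dehomogenise_prod dehomogenise_conj_quadratic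
    by (simp add: \<alpha>_def complex_cnj)
  then have "poly_over L (\<Prod>j\<in>UNIV. conj_pair (x j) (y j))"
    using dehomogenise_int_form_over[OF L, of F] by (simp add: G_def)
  moreover have "\<i> \<in> L" by (simp add: L_def subfield_0[OF K] subfield_1[OF K])
  ultimately have "complex_of_real (\<Sum>j\<in>UNIV. x j / y j) \<in> L \<and> complex_of_real (\<Sum>j\<in>UNIV. (x j)\<^sup>2 / y j) \<in> L"
    unfolding of_real_sum
    by (intro weighted_sums_in_subfield[OF L]) (use y yK real_L in auto)
  then have sums: "complex_of_real (\<Sum>j\<in>UNIV. x j / y j) \<in> K" "complex_of_real (\<Sum>j\<in>UNIV. (x j)\<^sup>2 / y j) \<in> K"
    unfolding real_L by auto
  have "psi a d = - (\<Sum>j\<in>UNIV. x j / y j) / T"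
    unfolding psi by (simp add: x_def y_def sum_negf)
  then have psi_a: "complex_of_real (psi a d) \<in> K"
    using sums(1) TK by (auto intro!: subfield_divide[OF K] subfield_uminus[OF K] simp del: of_real_sum)
  have bd: "b $ j / d $ j = ((x j)\<^sup>2 / y j + y j) / 2" for j
    using y[of j] by (simp add: b y_def add_divide_distrib power2_eq_square)
  have "psi b d = ((\<Sum>j\<in>UNIV. (x j)\<^sup>2 / y j) + (\<Sum>j\<in>UNIV. y j)) / 2 / T"
    unfolding psi bd by (simp only: sum.distrib sum_divide_distrib[symmetric])
  moreover have "complex_of_real (\<Sum>j\<in>UNIV. y j) \<in> K"
    using yK by (auto intro!: subfield_sum[OF K])
  ultimately have psi_b: "complex_of_real (psi b d) \<in> K"
    using sums(2) TK
    by (auto intro!: subfield_divide[OF K] subfield_mult[OF K] subfield_add[OF K] subfield_numeral[OF K]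
          simp del: of_real_sum)
  have "(cmod (hyp_center_zero G))\<^sup>2 = psi b d"
    unfolding cmod_power2 re im(2) by (simp add: power_divide)
  then have "hyp_center_quadratic G =
      [:[:0, 0, complex_of_real (psi b d):], [:0, complex_of_real (psi a d):], 1:]"
    unfolding hyp_center_quadratic_def conj_quadratic_explicit re by simp
  then have "form_defined_over K (hyp_center_quadratic G)"
    using psi_a psi_b subfield_0[OF K] subfield_1[OF K]
    by (auto simp: form_defined_over_def coeff_pCons one_pCons split: nat.split)
  with re im show ?thesis
    unfolding K_def G_def by (auto simp: upper_half_plane_def)
qed

end
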